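(* Let $\mathfrak{g}$ be a unimodular $4$-dimensional real Lie algebra endowed with an almost complex structure $J$. Then $$H^2(\mathfrak{g})=H_J^+(\mathfrak{g})\oplus H_J^-(\mathfrak{g}).$$
   Context: $\mathfrak{g}$ is unimodular if $\mathrm{tr}(\mathrm{ad}_\xi)=0$ for all $\xi\in\mathfrak{g}$. $H^*(\mathfrak{g})$ is the Chevalley–Eilenberg cohomology of $(\Lambda^*(\mathfrak{g}^* ),d)$, $d\phi(u,v)=-\phi([u,v])$ on $1$-forms. An almost complex structure is a linear automorphism $J$ of the vector space $\mathfrak{g}$ with $J^2=-\mathrm{id}$. $\Lambda_J^{\pm}(\mathfrak{g}^* )$ are the $\pm1$-eigenspaces of $\alpha(\cdot,\cdot)\mapsto\alpha(J\cdot,J\cdot)$ on $\Lambda^2(\mathfrak{g}^* )$, and $H_J^{\pm}(\mathfrak{g})\subset H^2(\mathfrak{g})$ is the subspace of classes that can be represented by a closed form in $\Lambda_J^\pm(\mathfrak{g}^* )$. *)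

theory Defs
  imports "HOL-Analysis.Analysis" "HOL-Library.Function_Algebras" "HOL-Library.Set_Algebras"
begin

text \<open>The Lie algebra is the whole type \<open>'a::real_vector\<close> (an abstract real vector space,
  with no preferred basis, norm or inner product) together with a bracket.\<close>

definition lie_algebra :: "('a::real_vector \<Rightarrow> 'a \<Rightarrow> 'a) \<Rightarrow> bool" where
  "lie_algebra br \<longleftrightarrow> bilinear br \<and> (\<forall>x. br x x = 0) \<and>
     (\<forall>x y z. br x (br y z) + br y (br z x) + br z (br x y) = 0)"

text \<open>The library's \<open>trace\<close> is for matrices only.  The choice of the basis is immaterial for
  linear \<open>f\<close> on a finite-dimensional space: see \<open>endo_trace_eq\<close>.\<close>

definition endo_trace :: "('a::real_vector \<Rightarrow> 'a) \<Rightarrow> real" where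
  "endo_trace f = (let B = real_vector.extend_basis {} in \<Sum>b\<in>B. representation B (f b) b)"

lemma endo_trace_eq:
  fixes f :: "'a::real_vector \<Rightarrow> 'a"
  assumes f: "linear f" and B: "independent B" "span B = UNIV" "finite B"
  shows "endo_trace f = (\<Sum>b\<in>B. representation B (f b) b)"
proof -
  define C where "C = (real_vector.extend_basis {} :: 'a set)"
  have C: "independent C" "span C = UNIV"
    by (simp_all add: C_def real_vector.independent_extend_basis real_vector.independent_empty
        real_vector.span_extend_basis)
  have fC: "finite C"
    using real_vector.independent_span_bound[OF B(3) C(1)] B(2) by simp
  have expand: "(\<Sum>b\<in>D. representation D v b *\<^sub>R b) = v"
    if "independent D" "span D = UNIV" "finite D" for D :: "'a set" and v
    using real_vector.sum_representation_eq[OF that(1) _ that(3) subset_refl] that(2) by simp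
  have lin_rep: "representation D (\<Sum>i\<in>I. c i *\<^sub>R g i) d = (\<Sum>i\<in>I. c i * representation D (g i) d)"
    if "independent D" "span D = UNIV" for D :: "'a set" and c g d and I :: "'a set"
  proof -
    have "representation D (\<Sum>i\<in>I. c i *\<^sub>R g i) = (\<lambda>d. \<Sum>i\<in>I. representation D (c i *\<^sub>R g i) d)"
      by (rule real_vector.representation_sum) (use that in auto)
    then show ?thesis
      using that by (simp add: real_vector.representation_scale)
  qed
  have "(\<Sum>b\<in>B. representation B (f b) b)
      = (\<Sum>b\<in>B. \<Sum>c\<in>C. representation C b c * representation B (f c) b)"
  proof (rule sum.cong[OF refl])
    fix b
    have "f b = f (\<Sum>c\<in>C. representation C b c *\<^sub>R c)"
      using expand[OF C fC] by simp
    also have "\<dots> = (\<Sum>c\<in>C. representation C b c *\<^sub>R f c)"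
      using f by (simp add: linear_sum linear_scale)
    finally show "representation B (f b) b
        = (\<Sum>c\<in>C. representation C b c * representation B (f c) b)"
      using lin_rep[OF B(1,2)] by simp
  qed
  also have "\<dots> = (\<Sum>c\<in>C. \<Sum>b\<in>B. representation B (f c) b * representation C b c)"
    by (subst sum.swap) (simp add: mult.commute)
  also have "\<dots> = (\<Sum>c\<in>C. representation C (f c) c)"
    using lin_rep[OF C, symmetric] expand[OF B] by simp
  finally show ?thesis
    by (simp add: endo_trace_def C_def Let_def)
qed

definition unimodular :: "('a::real_vector \<Rightarrow> 'a \<Rightarrow> 'a) \<Rightarrow> bool" where
  "unimodular br \<longleftrightarrow> (\<forall>\<xi>. endo_trace (br \<xi>) = 0)"

definition almost_complex_structure :: "('a::real_vector \<Rightarrow> 'a) \<Rightarrow> bool" where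
  "almost_complex_structure J \<longleftrightarrow> linear J \<and> (\<forall>v. J (J v) = - v)"

text \<open>A \<open>k\<close>-form takes the list of its \<open>k\<close> arguments; it is set to 0 on lists of any other
  length, so that equality of forms is equality of functions.\<close>

definition alt_forms :: "nat \<Rightarrow> ('a::real_vector list \<Rightarrow> real) set" where
  "alt_forms k = {\<omega>.
     (\<forall>xs. length xs \<noteq> k \<longrightarrow> \<omega> xs = 0) \<and>
     (\<forall>xs i. length xs = k \<and> i < k \<longrightarrow> linear (\<lambda>v. \<omega> (xs[i := v]))) \<and>
     (\<forall>xs. length xs = k \<and> \<not> distinct xs \<longrightarrow> \<omega> xs = 0)}"

text \<open>\<open>d\<omega>(x\<^sub>0,\<dots>,x\<^sub>k) = \<Sum>\<^sub>i\<^sub><\<^sub>j (-1)\<^sup>i\<^sup>+\<^sup>j \<omega>([x\<^sub>i,x\<^sub>j], x\<^sub>0,\<dots>)\<close>, the dots omitting \<open>x\<^sub>i\<close> and \<open>x\<^sub>j\<close>.\<close>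

definition ce_diff ::
  "('a::real_vector \<Rightarrow> 'a \<Rightarrow> 'a) \<Rightarrow> ('a list \<Rightarrow> real) \<Rightarrow> 'a list \<Rightarrow> real" where
  "ce_diff br \<omega> xs =
     (\<Sum>j<length xs. \<Sum>i<j. (-1) ^ (i + j) * \<omega> (br (xs ! i) (xs ! j) # nths xs (- {i, j})))"

definition closed_forms :: "('a::real_vector \<Rightarrow> 'a \<Rightarrow> 'a) \<Rightarrow> nat \<Rightarrow> ('a list \<Rightarrow> real) set" where
  "closed_forms br k = {\<omega> \<in> alt_forms k. ce_diff br \<omega> = 0}"

text \<open>For \<open>k = 0\<close> only the zero form is exact.\<close>

definition exact_forms :: "('a::real_vector \<Rightarrow> 'a \<Rightarrow> 'a) \<Rightarrow> nat \<Rightarrow> ('a list \<Rightarrow> real) set" where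
  "exact_forms br k = (case k of 0 \<Rightarrow> {0} | Suc m \<Rightarrow> ce_diff br ` alt_forms m)"

text \<open>Cohomology classes are the cosets of the exact forms.  Addition of classes is the
  elementwise addition of sets from \<open>HOL-Library.Set_Algebras\<close>, cf. \<open>ce_class_add\<close>.\<close>

definition ce_class ::
  "('a::real_vector \<Rightarrow> 'a \<Rightarrow> 'a) \<Rightarrow> nat \<Rightarrow> ('a list \<Rightarrow> real) \<Rightarrow> ('a list \<Rightarrow> real) set" where
  "ce_class br k \<omega> = \<omega> +o exact_forms br k"

definition ce_cohomology ::
  "('a::real_vector \<Rightarrow> 'a \<Rightarrow> 'a) \<Rightarrow> nat \<Rightarrow> ('a list \<Rightarrow> real) set set" where
  "ce_cohomology br k = ce_class br k ` closed_forms br k"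

definition J_invariant_forms :: "('a::real_vector \<Rightarrow> 'a) \<Rightarrow> ('a list \<Rightarrow> real) set" where
  "J_invariant_forms J = {\<alpha> \<in> alt_forms 2. \<forall>u v. \<alpha> [J u, J v] = \<alpha> [u, v]}"

definition J_anti_invariant_forms :: "('a::real_vector \<Rightarrow> 'a) \<Rightarrow> ('a list \<Rightarrow> real) set" where
  "J_anti_invariant_forms J = {\<alpha> \<in> alt_forms 2. \<forall>u v. \<alpha> [J u, J v] = - \<alpha> [u, v]}"

definition H_J_plus ::
  "('a::real_vector \<Rightarrow> 'a \<Rightarrow> 'a) \<Rightarrow> ('a \<Rightarrow> 'a) \<Rightarrow> ('a list \<Rightarrow> real) set set" where
  "H_J_plus br J = ce_class br 2 ` (closed_forms br 2 \<inter> J_invariant_forms J)"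

definition H_J_minus ::
  "('a::real_vector \<Rightarrow> 'a \<Rightarrow> 'a) \<Rightarrow> ('a \<Rightarrow> 'a) \<Rightarrow> ('a list \<Rightarrow> real) set set" where
  "H_J_minus br J = ce_class br 2 ` (closed_forms br 2 \<inter> J_anti_invariant_forms J)"

text \<open>\<open>V = A \<oplus> B\<close>, for subspaces \<open>A\<close> and \<open>B\<close> of \<open>V\<close>: every element of \<open>V\<close> is the sum of a unique
  element of \<open>A\<close> and a unique element of \<open>B\<close>.\<close>

definition internal_direct_sum :: "'v::plus set \<Rightarrow> 'v set \<Rightarrow> 'v set \<Rightarrow> bool" where
  "internal_direct_sum V A B \<longleftrightarrow>
     A \<subseteq> V \<and> B \<subseteq> V \<and> bij_betw (\<lambda>(a, b). a + b) (A \<times> B) V"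

lemma alt_forms_lincomb:
  assumes "\<omega> \<in> alt_forms k" "\<eta> \<in> alt_forms k"
  shows "(\<lambda>xs. a * \<omega> xs + b * \<eta> xs) \<in> alt_forms k"
  using assms unfolding alt_forms_def
  by (auto intro!: linear_compose_add linear_compose_scale_right[where 'b = real, simplified])

lemma ce_diff_lincomb:
  "ce_diff br (\<lambda>xs. a * \<omega> xs + b * \<eta> xs) xs = a * ce_diff br \<omega> xs + b * ce_diff br \<eta> xs"
  by (simp add: ce_diff_def sum_distrib_left sum.distrib algebra_simps)

lemma exact_forms_lincomb:
  assumes "\<omega> \<in> exact_forms br k" "\<eta> \<in> exact_forms br k"
  shows "(\<lambda>xs. a * \<omega> xs + b * \<eta> xs) \<in> exact_forms br k"
proof (cases k)
  case 0
  with assms show ?thesis by (simp add: exact_forms_def zero_fun_def)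
next
  case (Suc m)
  with assms obtain \<sigma> \<tau> where *: "\<sigma> \<in> alt_forms m" "\<tau> \<in> alt_forms m"
    "\<omega> = ce_diff br \<sigma>" "\<eta> = ce_diff br \<tau>"
    by (auto simp: exact_forms_def)
  then have "(\<lambda>xs. a * \<omega> xs + b * \<eta> xs) = ce_diff br (\<lambda>xs. a * \<sigma> xs + b * \<tau> xs)"
    by (auto simp: ce_diff_lincomb)
  with * Suc alt_forms_lincomb[of \<sigma> m \<tau> a b] show ?thesis
    by (auto simp: exact_forms_def)
qed

lemma closed_forms_lincomb:
  assumes "\<omega> \<in> closed_forms br k" "\<eta> \<in> closed_forms br k"
  shows "(\<lambda>xs. a * \<omega> xs + b * \<eta> xs) \<in> closed_forms br k"
  using assms alt_forms_lincomb[of \<omega> k \<eta> a b]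
  by (auto simp: closed_forms_def fun_eq_iff ce_diff_lincomb)

lemma exact_forms_0: "0 \<in> exact_forms br k"
proof -
  have "0 \<in> alt_forms m" for m :: nat
    by (auto simp: alt_forms_def linear_iff)
  moreover have "ce_diff br 0 = 0"
    by (auto simp: ce_diff_def)
  ultimately show ?thesis
    by (force simp: exact_forms_def split: nat.split)
qed

lemma ce_class_add: "ce_class br k \<omega> + ce_class br k \<eta> = ce_class br k (\<omega> + \<eta>)"
proof -
  have "\<beta> + \<gamma> \<in> exact_forms br k"
    if "\<beta> \<in> exact_forms br k" "\<gamma> \<in> exact_forms br k" for \<beta> \<gamma>
    using exact_forms_lincomb[OF that, of 1 1] by (simp add: plus_fun_def)
  then have "exact_forms br k + exact_forms br k = exact_forms br k"
    using exact_forms_0[of br k] by (force simp: set_plus_def)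
  then show ?thesis
    by (simp add: ce_class_def set_plus_rearrange)
qed

lemma ce_class_eq_iff: "ce_class br k \<omega> = ce_class br k \<eta> \<longleftrightarrow> \<omega> - \<eta> \<in> exact_forms br k"
proof
  assume "ce_class br k \<omega> = ce_class br k \<eta>"
  moreover have "\<omega> \<in> ce_class br k \<omega>"
    using exact_forms_0[of br k] by (force simp: ce_class_def elt_set_plus_def)
  ultimately show "\<omega> - \<eta> \<in> exact_forms br k"
    by (auto simp: ce_class_def elt_set_plus_def)
next
  assume *: "\<omega> - \<eta> \<in> exact_forms br k"
  have plus: "(\<omega> - \<eta>) + \<gamma> \<in> exact_forms br k" if "\<gamma> \<in> exact_forms br k" for \<gamma>
    using exact_forms_lincomb[OF * that, of 1 1] by (simp add: plus_fun_def)
  have minus: "\<gamma> - (\<omega> - \<eta>) \<in> exact_forms br k" if "\<gamma> \<in> exact_forms br k" for \<gamma>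
  proof -
    have "(\<lambda>xs. 1 * \<gamma> xs + (-1) * (\<omega> - \<eta>) xs) = \<gamma> - (\<omega> - \<eta>)"
      by (rule ext) simp
    then show ?thesis
      using exact_forms_lincomb[OF that *, of 1 "-1"] by simp
  qed
  show "ce_class br k \<omega> = ce_class br k \<eta>"
  proof (intro equalityI subsetI)
    fix x assume "x \<in> ce_class br k \<omega>"
    then obtain \<gamma> where \<gamma>: "\<gamma> \<in> exact_forms br k" "x = \<omega> + \<gamma>"
      by (auto simp: ce_class_def elt_set_plus_def)
    show "x \<in> ce_class br k \<eta>"
      using plus[OF \<gamma>(1)] \<gamma>(2) unfolding ce_class_def elt_set_plus_def
      by (intro CollectI bexI[of _ "(\<omega> - \<eta>) + \<gamma>"]) (auto simp: algebra_simps)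
  next
    fix x assume "x \<in> ce_class br k \<eta>"
    then obtain \<gamma> where \<gamma>: "\<gamma> \<in> exact_forms br k" "x = \<eta> + \<gamma>"
      by (auto simp: ce_class_def elt_set_plus_def)
    show "x \<in> ce_class br k \<omega>"
      using minus[OF \<gamma>(1)] \<gamma>(2) unfolding ce_class_def elt_set_plus_def
      by (intro CollectI bexI[of _ "\<gamma> - (\<omega> - \<eta>)"]) (auto simp: algebra_simps)
  qed
qed

lemma ce_diff_1: "ce_diff br \<phi> [u, v] = - \<phi> [br u v]"
  by (simp add: ce_diff_def nths_Cons numeral_2_eq_2)

lemma ce_diff_2:
  "ce_diff br \<omega> [u, v, w] = - \<omega> [br u v, w] + \<omega> [br u w, v] - \<omega> [br v w, u]"
  by (simp add: ce_diff_def nths_Cons eval_nat_numeral)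

lemma exact_forms_2_closed:
  assumes "lie_algebra br"
  shows "exact_forms br 2 \<subseteq> closed_forms br 2"
proof
  fix \<omega> assume "\<omega> \<in> exact_forms br 2"
  then obtain \<phi> where \<phi>: "\<phi> \<in> alt_forms 1" and \<omega>: "\<omega> = ce_diff br \<phi>"
    by (auto simp: exact_forms_def numeral_2_eq_2)
  have lin: "linear (\<lambda>v. \<phi> [v])"
  proof -
    have "\<forall>xs i. length xs = 1 \<and> i < 1 \<longrightarrow> linear (\<lambda>v. \<phi> (xs[i := v]))"
      using \<phi> unfolding alt_forms_def by blast
    from this[rule_format, of "[0]" 0] show ?thesis by simp
  qed
  have bil: "bilinear br" and alt: "br x x = 0"
    and jac: "br x (br y z) + br y (br z x) + br z (br x y) = 0" for x y z
    using assms by (auto simp: lie_algebra_def)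
  have l1: "linear (br x)" and l2: "linear (\<lambda>y. br y x)" for x
    using bil by (auto simp: bilinear_def)
  have anti: "br x y = - br y x" for x y
  proof -
    have "br (x + y) (x + y) = br x x + br x y + (br y x + br y y)"
      using bil by (simp add: bilinear_ladd bilinear_radd)
    then show ?thesis using alt by (simp add: eq_neg_iff_add_eq_0)
  qed
  have \<omega>2: "\<omega> [u, v] = - \<phi> [br u v]" for u v
    by (simp add: \<omega> ce_diff_1)
  have off: "ce_diff br \<psi> xs = 0"
    if zero: "\<And>ys. length ys \<noteq> k \<Longrightarrow> \<psi> ys = 0" and len: "length xs \<noteq> Suc k" for \<psi> xs k
  proof -
    have "\<psi> (br (xs ! i) (xs ! j) # nths xs (- {i, j})) = 0" if ij: "j < length xs" "i < j" for i j
    proof (rule zero)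
      have "{m. m < length xs \<and> m \<in> - {i, j}} = {..<length xs} - {i, j}" by auto
      then have "length (nths xs (- {i, j})) = length xs - 2"
        using ij by (simp add: length_nths card_Diff_subset)
      then show "length (br (xs ! i) (xs ! j) # nths xs (- {i, j})) \<noteq> k"
        using ij len by simp
    qed
    then show ?thesis by (simp add: ce_diff_def)
  qed
  have off1: "\<phi> ys = 0" if "length ys \<noteq> 1" for ys
    using \<phi> that by (simp add: alt_forms_def)
  have off2: "\<omega> ys = 0" if "length ys \<noteq> 2" for ys
    unfolding \<omega> by (rule off[of 1]) (use off1 that in auto)
  have "\<omega> \<in> alt_forms 2"
  proof -
    have "linear (\<lambda>v. \<omega> (xs[i := v]))" if xs: "length xs = 2" "i < 2" for xs i
    proof -
      obtain a b where "xs = [a, b]"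
        using xs by (auto simp: length_Suc_conv numeral_2_eq_2)
      moreover have "linear (\<lambda>v. \<omega> [v, b])" "linear (\<lambda>v. \<omega> [a, v])"
        using linear_compose_neg[OF linear_compose[OF l2 lin]]
          linear_compose_neg[OF linear_compose[OF l1 lin]]
        by (simp_all add: \<omega>2 o_def)
      ultimately show ?thesis
        using xs by (auto simp: less_2_cases_iff)
    qed
    moreover have "\<omega> xs = 0" if xs: "length xs = 2" "\<not> distinct xs" for xs
    proof -
      obtain a where "xs = [a, a]"
        using xs by (auto simp: length_Suc_conv numeral_2_eq_2)
      then show ?thesis using linear_0[OF lin] by (simp add: \<omega>2 alt)
    qed
    ultimately show ?thesis using off2 by (simp add: alt_forms_def)
  qed
  moreover have "ce_diff br \<omega> xs = 0" for xs
  proof (cases "length xs = 3")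
    case True
    then obtain u v w where xs: "xs = [u, v, w]"
      by (auto simp: length_Suc_conv numeral_3_eq_3)
    have "ce_diff br \<omega> xs = \<phi> [br (br u v) w] - \<phi> [br (br u w) v] + \<phi> [br (br v w) u]"
      by (simp add: xs ce_diff_2 \<omega>2)
    also have "\<dots> = \<phi> [br (br u v) w - br (br u w) v + br (br v w) u]"
      using linear_add[OF lin] linear_diff[OF lin] by simp
    also have "br (br u v) w - br (br u w) v + br (br v w) u
        = - (br u (br v w) + br v (br w u) + br w (br u v))"
      proof -
      have "br (br u v) w = - br w (br u v)" "br (br v w) u = - br u (br v w)"
        by (rule anti)+
      moreover have "br (br u w) v = - br v (br u w)" by (rule anti)
      moreover have "br v (br w u) = - br v (br u w)"
        unfolding anti[of w u] by (rule bilinear_rneg[OF bil])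
      ultimately show ?thesis by (simp only: algebra_simps) simp
    qed
    finally show ?thesis using jac linear_0[OF lin] by simp
  next
    case False
    show ?thesis by (rule off[of 2]) (use off2 False in auto)
  qed
  ultimately show "\<omega> \<in> closed_forms br 2"
    by (auto simp: closed_forms_def)
qed

end

theory Submission
  imports Defs
begin

text \<open>
  Choosing a volume element turns the wedge product of 2-forms on a 4-dimensional space into a
  symmetric bilinear form \<open>Q\<close>.  Two facts about \<open>Q\<close> carry the proof.

  \<^item> In a \<open>J\<close>-adapted frame \<open>e, J e, g, J g\<close>, the anti-invariant forms are a plane \<open>P\<close> on which
    \<open>Q\<close> is positive definite, and \<open>Q\<close> pairs any \<open>\<alpha>\<close> with \<open>P\<close> only through its anti-invariant
    part.  In coordinates this is lemma \<open>wedge_top_anti_invariant\<close>: \<open>Q\<close> becomes the Euclidean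
    inner product of the two numbers \<open>anti_coords\<close> that determine the anti-invariant part.

  \<^item> Unimodularity says that every 3-form on the Lie algebra is closed, so
    \<open>d\<phi> \<and> \<alpha> = \<phi> \<and> d\<alpha>\<close> for a 1-form \<open>\<phi>\<close> and a 2-form \<open>\<alpha>\<close>.  As the pairing of 1-forms with
    3-forms is nondegenerate, the closed 2-forms are exactly the \<open>Q\<close>-orthogonal complement of the
    exact ones (\<open>closed_iff_wedge_top_exact\<close>).

  Let \<open>\<pi>\<close> be the projection to \<open>P\<close> along the invariant forms and \<open>B\<close> the space of exact forms.
  By both facts a form in \<open>P\<close> is closed iff it is orthogonal to \<open>\<pi>(B)\<close>; and since \<open>P\<close> is definite,
  it is the orthogonal sum of \<open>\<pi>(B)\<close> and of its closed elements.  Hence for a closed \<open>\<omega>\<close> there are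
  an exact \<open>\<eta>\<close> and a closed \<open>\<beta>\<close> in \<open>P\<close> with \<open>\<pi>(\<omega>) = \<pi>(\<eta>) + \<beta>\<close>, so that \<open>\<omega> - \<eta> - \<beta>\<close> is closed and
  invariant: the two subspaces span the cohomology.  Their sum is direct because, if \<open>\<alpha> + \<beta>\<close> is
  exact with \<open>\<alpha>\<close> invariant and \<open>\<beta>\<close> closed and anti-invariant, then
  \<open>0 = Q(\<alpha> + \<beta>, \<beta>) = Q(\<beta>, \<beta>)\<close> and definiteness gives \<open>\<beta> = 0\<close>.
\<close>

section \<open>Alternating forms and the differential\<close>

lemma alt_forms_1_linear:
  assumes "\<phi> \<in> alt_forms 1"
  shows "linear (\<lambda>v. \<phi> [v])"
proof -
  have "\<forall>xs i. length xs = 1 \<and> i < 1 \<longrightarrow> linear (\<lambda>v. \<phi> (xs[i := v]))"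
    using assms unfolding alt_forms_def by blast
  from this[rule_format, of "[0]" 0] show ?thesis by simp
qed

lemma alt_forms_1I:
  assumes "linear f"
  shows "(\<lambda>xs. if length xs = 1 then f (hd xs) else 0) \<in> alt_forms 1"
  using assms by (auto simp: alt_forms_def length_Suc_conv)

lemma alt_forms_2_linear:
  assumes "\<alpha> \<in> alt_forms 2"
  shows "linear (\<lambda>u. \<alpha> [u, v])" "linear (\<lambda>v. \<alpha> [u, v])"
proof -
  have *: "\<forall>xs i. length xs = 2 \<and> i < 2 \<longrightarrow> linear (\<lambda>v. \<alpha> (xs[i := v]))"
    using assms unfolding alt_forms_def by blast
  show "linear (\<lambda>u. \<alpha> [u, v])" using *[rule_format, of "[0, v]" 0] by simp
  show "linear (\<lambda>v. \<alpha> [u, v])" using *[rule_format, of "[u, 0]" 1] by simp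
qed

lemma alt_forms_2_same: "\<alpha> \<in> alt_forms 2 \<Longrightarrow> \<alpha> [u, u] = 0"
  by (simp add: alt_forms_def)

lemma alt_forms_2_swap:
  assumes "\<alpha> \<in> alt_forms 2"
  shows "\<alpha> [u, v] = - \<alpha> [v, u]"
proof -
  have "\<alpha> [u + v, u + v] = \<alpha> [u, u] + \<alpha> [u, v] + (\<alpha> [v, u] + \<alpha> [v, v])"
    by (simp only: linear_add[OF alt_forms_2_linear(1)[OF assms]]
        linear_add[OF alt_forms_2_linear(2)[OF assms]])
  then show ?thesis by (simp add: alt_forms_2_same[OF assms])
qed

lemma alt_forms_2I:
  assumes "bilinear f" and "\<And>u. f u u = 0"
  shows "(\<lambda>xs. if length xs = 2 then f (xs ! 0) (xs ! 1) else 0) \<in> alt_forms 2"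
  using assms
  by (auto simp: alt_forms_def length_Suc_conv numeral_2_eq_2 bilinear_def less_Suc_eq)

text \<open>Forms take argument lists of every length, so equality of 2-forms also needs the convention
  that they vanish on lists of the wrong length.\<close>

lemma form_eqI:
  assumes "\<alpha> \<in> alt_forms 2" "\<beta> \<in> alt_forms 2" "\<And>u v. \<alpha> [u, v] = \<beta> [u, v]"
  shows "\<alpha> = \<beta>"
proof
  fix xs
  show "\<alpha> xs = \<beta> xs"
  proof (cases "length xs = 2")
    case True
    then obtain u v where "xs = [u, v]"
      by (auto simp: length_Suc_conv numeral_2_eq_2)
    with assms(3) show ?thesis by simp
  next
    case False
    with assms(1,2) show ?thesis by (simp add: alt_forms_def)
  qed
qed

lemma lie_algebra_bracket:
  assumes "lie_algebra br"
  shows "bilinear br" "br u u = 0" "br u v = - br v u"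
proof -
  show bil: "bilinear br" and alt: "br u u = 0" for u
    using assms by (auto simp: lie_algebra_def)
  have "br (u + v) (u + v) = br u u + br u v + (br v u + br v v)"
    using bil by (simp add: bilinear_ladd bilinear_radd)
  then show "br u v = - br v u" using alt by (simp add: eq_neg_iff_add_eq_0)
qed

lemma ce_diff_eq_0_off_degree:
  assumes "\<omega> \<in> alt_forms k" and "length xs \<noteq> Suc k"
  shows "ce_diff br \<omega> xs = 0"
proof -
  have "\<omega> (br (xs ! i) (xs ! j) # nths xs (- {i, j})) = 0" if ij: "j < length xs" "i < j" for i j
  proof -
    have "{m. m < length xs \<and> m \<in> - {i, j}} = {..<length xs} - {i, j}" by auto
    then have "length (nths xs (- {i, j})) = length xs - 2"
      using ij by (simp add: length_nths card_Diff_subset)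
    then show ?thesis using ij assms by (auto simp: alt_forms_def)
  qed
  then show ?thesis by (simp add: ce_diff_def)
qed

text \<open>These two transpositions generate all permutations of the arguments, so linearity in the first
  argument is enough to know that \<open>d\<alpha>\<close> is an alternating trilinear form.\<close>

lemma ce_diff_2_alternating:
  assumes "lie_algebra br" and \<alpha>: "\<alpha> \<in> alt_forms 2"
  shows "linear (\<lambda>u. ce_diff br \<alpha> [u, v, w])"
    and "ce_diff br \<alpha> [u, v, w] = - ce_diff br \<alpha> [v, u, w]"
    and "ce_diff br \<alpha> [u, v, w] = - ce_diff br \<alpha> [u, w, v]"
proof -
  note br = lie_algebra_bracket[OF assms(1)]
  note lin = alt_forms_2_linear[OF \<alpha>]
  have neg: "\<alpha> [- a, b] = - \<alpha> [a, b]" for a b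
    using linear_neg[OF lin(1)] .
  show "linear (\<lambda>u. ce_diff br \<alpha> [u, v, w])"
    by (rule linearI)
      (simp_all add: ce_diff_2 bilinear_ladd[OF br(1)] bilinear_lmul[OF br(1)]
        linear_add[OF lin(1)] linear_add[OF lin(2)] linear_scale[OF lin(1)]
        linear_scale[OF lin(2)] algebra_simps)
  show "ce_diff br \<alpha> [u, v, w] = - ce_diff br \<alpha> [v, u, w]"
    using br(3)[of u v] by (simp add: ce_diff_2 neg)
  show "ce_diff br \<alpha> [u, v, w] = - ce_diff br \<alpha> [u, w, v]"
    using br(3)[of v w] by (simp add: ce_diff_2 neg)
qed

section \<open>Frames adapted to an almost complex structure\<close>

text \<open>The \<open>x\<^sub>i\<close> are the coordinate functions of the basis \<open>e\<^sub>1, J e\<^sub>1, e\<^sub>3, J e\<^sub>3\<close>.  Keeping them as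
  four explicit functionals reduces the linear algebra of the proof to ring identities.\<close>

locale adapted_frame =
  fixes J :: "'a::real_vector \<Rightarrow> 'a" and e1 e2 e3 e4 :: 'a and x1 x2 x3 x4 :: "'a \<Rightarrow> real"
  assumes J: "linear J"
    and J_e: "J e1 = e2" "J e2 = - e1" "J e3 = e4" "J e4 = - e3"
    and x_linear: "linear x1" "linear x2" "linear x3" "linear x4"
    and x_e: "x1 e1 = 1" "x1 e2 = 0" "x1 e3 = 0" "x1 e4 = 0"
      "x2 e1 = 0" "x2 e2 = 1" "x2 e3 = 0" "x2 e4 = 0"
      "x3 e1 = 0" "x3 e2 = 0" "x3 e3 = 1" "x3 e4 = 0"
      "x4 e1 = 0" "x4 e2 = 0" "x4 e3 = 0" "x4 e4 = 1"
    and expand: "v = x1 v *\<^sub>R e1 + x2 v *\<^sub>R e2 + x3 v *\<^sub>R e3 + x4 v *\<^sub>R e4"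
begin

lemma span_frame: "v \<in> span {e1, e2, e3, e4}"
proof -
  have "x1 v *\<^sub>R e1 + x2 v *\<^sub>R e2 + x3 v *\<^sub>R e3 + x4 v *\<^sub>R e4 \<in> span {e1, e2, e3, e4}"
    by (simp add: span_add span_scale span_base)
  then show ?thesis by (simp only: expand[symmetric])
qed

lemma linear_expand:
  assumes "linear f"
  shows "f v = x1 v *\<^sub>R f e1 + x2 v *\<^sub>R f e2 + x3 v *\<^sub>R f e3 + x4 v *\<^sub>R f e4"
  by (subst expand) (simp only: linear_add[OF assms] linear_scale[OF assms])

lemma linear_expand_real:
  fixes f :: "'a \<Rightarrow> real"
  assumes "linear f"
  shows "f v = x1 v * f e1 + x2 v * f e2 + x3 v * f e3 + x4 v * f e4"
  unfolding linear_expand[OF assms, of v] by simp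

lemmas x_simps = x_linear[THEN linear_0] x_linear[THEN linear_add] x_linear[THEN linear_diff]
  x_linear[THEN linear_neg] x_linear[THEN linear_scale] x_e

lemma x_J: "x1 (J v) = - x2 v" "x2 (J v) = x1 v" "x3 (J v) = - x4 v" "x4 (J v) = x3 v"
  unfolding linear_expand[OF J, of v] by (simp_all add: J_e x_simps)

lemma form_expand:
  assumes \<alpha>: "\<alpha> \<in> alt_forms 2"
  shows "\<alpha> [u, v] =
      \<alpha> [e1, e2] * (x1 u * x2 v - x2 u * x1 v) + \<alpha> [e1, e3] * (x1 u * x3 v - x3 u * x1 v)
    + \<alpha> [e1, e4] * (x1 u * x4 v - x4 u * x1 v) + \<alpha> [e2, e3] * (x2 u * x3 v - x3 u * x2 v)
    + \<alpha> [e2, e4] * (x2 u * x4 v - x4 u * x2 v) + \<alpha> [e3, e4] * (x3 u * x4 v - x4 u * x3 v)"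
proof -
  note lin = alt_forms_2_linear[OF \<alpha>]
  have sw: "\<alpha> [e2, e1] = - \<alpha> [e1, e2]" "\<alpha> [e3, e1] = - \<alpha> [e1, e3]" "\<alpha> [e4, e1] = - \<alpha> [e1, e4]"
    "\<alpha> [e3, e2] = - \<alpha> [e2, e3]" "\<alpha> [e4, e2] = - \<alpha> [e2, e4]" "\<alpha> [e4, e3] = - \<alpha> [e3, e4]"
    by (rule alt_forms_2_swap[OF \<alpha>])+
  have left: "\<alpha> [u, v] = x1 u * \<alpha> [e1, v] + x2 u * \<alpha> [e2, v] + x3 u * \<alpha> [e3, v] + x4 u * \<alpha> [e4, v]"
    by (rule linear_expand_real[OF lin(1)])
  have right: "\<alpha> [a, v] =
      x1 v * \<alpha> [a, e1] + x2 v * \<alpha> [a, e2] + x3 v * \<alpha> [a, e3] + x4 v * \<alpha> [a, e4]" for a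
    by (rule linear_expand_real[OF lin(2)])
  show ?thesis
    unfolding left right[of e1] right[of e2] right[of e3] right[of e4] sw alt_forms_2_same[OF \<alpha>]
    by (simp add: algebra_simps)
qed

text \<open>The value of \<open>\<alpha> \<and> \<beta>\<close> on the frame.\<close>

definition wedge_top :: "('a list \<Rightarrow> real) \<Rightarrow> ('a list \<Rightarrow> real) \<Rightarrow> real" where
  "wedge_top \<alpha> \<beta> =
      \<alpha> [e1, e2] * \<beta> [e3, e4] - \<alpha> [e1, e3] * \<beta> [e2, e4] + \<alpha> [e1, e4] * \<beta> [e2, e3]
    + \<alpha> [e2, e3] * \<beta> [e1, e4] - \<alpha> [e2, e4] * \<beta> [e1, e3] + \<alpha> [e3, e4] * \<beta> [e1, e2]"

lemma wedge_top_commute: "wedge_top \<alpha> \<beta> = wedge_top \<beta> \<alpha>"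
  by (simp add: wedge_top_def)

text \<open>The anti-invariant forms are spanned by the real and imaginary parts of
  \<open>(x\<^sub>1 + \<i> x\<^sub>2) \<and> (x\<^sub>3 + \<i> x\<^sub>4)\<close>.  Up to a factor 2, the pair below gives the coefficients of the
  anti-invariant part of \<open>\<alpha>\<close> in this basis.\<close>

definition anti_coords :: "('a list \<Rightarrow> real) \<Rightarrow> real \<times> real" where
  "anti_coords \<alpha> = (\<alpha> [e1, e3] - \<alpha> [e2, e4], \<alpha> [e1, e4] + \<alpha> [e2, e3])"

lemma anti_coords_lincomb:
  "anti_coords (\<lambda>xs. a * \<alpha> xs + b * \<beta> xs) = a *\<^sub>R anti_coords \<alpha> + b *\<^sub>R anti_coords \<beta>"
  by (simp add: anti_coords_def algebra_simps)

lemma anti_invariant_on_frame: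
  assumes "\<beta> \<in> J_anti_invariant_forms J"
  shows "\<beta> [e1, e2] = 0" "\<beta> [e3, e4] = 0" "\<beta> [e2, e4] = - \<beta> [e1, e3]" "\<beta> [e2, e3] = \<beta> [e1, e4]"
proof -
  have \<beta>: "\<beta> \<in> alt_forms 2" and anti: "\<beta> [J u, J v] = - \<beta> [u, v]" for u v
    using assms by (auto simp: J_anti_invariant_forms_def)
  have neg: "\<beta> [u, - v] = - \<beta> [u, v]" for u v
    using linear_neg[OF alt_forms_2_linear(2)[OF \<beta>]] .
  show "\<beta> [e1, e2] = 0"
    using anti[of e1 e2] alt_forms_2_swap[OF \<beta>, of e2 e1] by (simp add: J_e neg)
  show "\<beta> [e3, e4] = 0"
    using anti[of e3 e4] alt_forms_2_swap[OF \<beta>, of e4 e3] by (simp add: J_e neg)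
  show "\<beta> [e2, e4] = - \<beta> [e1, e3]"
    using anti[of e1 e3] by (simp add: J_e)
  show "\<beta> [e2, e3] = \<beta> [e1, e4]"
    using anti[of e1 e4] by (simp add: J_e neg)
qed

text \<open>An anti-invariant \<open>\<beta>\<close> has \<open>\<beta>\<^sub>1\<^sub>2 = \<beta>\<^sub>3\<^sub>4 = 0\<close>, \<open>\<beta>\<^sub>2\<^sub>4 = -\<beta>\<^sub>1\<^sub>3\<close> and \<open>\<beta>\<^sub>2\<^sub>3 = \<beta>\<^sub>1\<^sub>4\<close>, so the four
  surviving terms of \<open>\<alpha> \<and> \<beta>\<close> group into \<open>(\<alpha>\<^sub>1\<^sub>3 - \<alpha>\<^sub>2\<^sub>4) \<beta>\<^sub>1\<^sub>3 + (\<alpha>\<^sub>1\<^sub>4 + \<alpha>\<^sub>2\<^sub>3) \<beta>\<^sub>1\<^sub>4\<close>.  This shows at once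
  that the wedge product is definite on anti-invariant forms and that these are orthogonal to the
  invariant ones.\<close>

lemma wedge_top_anti_invariant:
  assumes "\<beta> \<in> J_anti_invariant_forms J"
  shows "wedge_top \<alpha> \<beta> = inner (anti_coords \<alpha>) (anti_coords \<beta>) / 2"
  by (simp add: wedge_top_def anti_coords_def anti_invariant_on_frame[OF assms] algebra_simps)

lemma anti_coords_eq_0_iff_invariant:
  assumes \<alpha>: "\<alpha> \<in> alt_forms 2"
  shows "anti_coords \<alpha> = 0 \<longleftrightarrow> \<alpha> \<in> J_invariant_forms J"
proof
  assume "anti_coords \<alpha> = 0"
  then have *: "\<alpha> [e2, e4] = \<alpha> [e1, e3]" "\<alpha> [e2, e3] = - \<alpha> [e1, e4]"
    by (simp_all add: anti_coords_def zero_prod_def)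
  have "\<alpha> [J u, J v] = \<alpha> [u, v]" for u v
    unfolding form_expand[OF \<alpha>, of "J u" "J v"] form_expand[OF \<alpha>, of u v] x_J *
    by (simp add: algebra_simps)
  with \<alpha> show "\<alpha> \<in> J_invariant_forms J" by (simp add: J_invariant_forms_def)
next
  assume "\<alpha> \<in> J_invariant_forms J"
  then have inv: "\<alpha> [J u, J v] = \<alpha> [u, v]" for u v
    by (auto simp: J_invariant_forms_def)
  have neg: "\<alpha> [u, - v] = - \<alpha> [u, v]" for u v
    using linear_neg[OF alt_forms_2_linear(2)[OF \<alpha>]] .
  show "anti_coords \<alpha> = 0"
    using inv[of e1 e3] inv[of e1 e4] by (simp add: anti_coords_def J_e neg zero_prod_def)
qed

lemma anti_invariant_eq_0:
  assumes "\<beta> \<in> J_anti_invariant_forms J" and "anti_coords \<beta> = 0"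
  shows "\<beta> [u, v] = 0"
proof -
  have \<beta>: "\<beta> \<in> alt_forms 2" using assms by (simp add: J_anti_invariant_forms_def)
  have "\<beta> [e1, e3] = 0" "\<beta> [e1, e4] = 0"
    using assms(2) by (simp_all add: anti_coords_def anti_invariant_on_frame[OF assms(1)] zero_prod_def)
  then show ?thesis
    by (subst form_expand[OF \<beta>]) (simp add: anti_invariant_on_frame[OF assms(1)])
qed

lemma anti_invariant_form_with_coords:
  obtains \<beta> where "\<beta> \<in> J_anti_invariant_forms J" "anti_coords \<beta> = p"
proof -
  obtain s t where p: "p = (s, t)" by fastforce
  define f where "f u v =
      s / 2 * (x1 u * x3 v - x3 u * x1 v - (x2 u * x4 v - x4 u * x2 v))
    + t / 2 * (x1 u * x4 v - x4 u * x1 v + (x2 u * x3 v - x3 u * x2 v))" for u v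
  define \<beta> where "\<beta> = (\<lambda>xs. if length xs = 2 then f (xs ! 0) (xs ! 1) else 0)"
  have "bilinear f"
    unfolding bilinear_def f_def
    by (intro conjI allI linearI)
      (simp_all add: x_simps algebra_simps)
  then have alt: "\<beta> \<in> alt_forms 2"
    unfolding \<beta>_def by (rule alt_forms_2I) (simp add: f_def)
  have \<beta>: "\<beta> [u, v] = f u v" for u v
    by (simp add: \<beta>_def)
  have "\<beta> [J u, J v] = - \<beta> [u, v]" for u v
    unfolding \<beta> f_def x_J by (simp add: field_simps)
  with alt have "\<beta> \<in> J_anti_invariant_forms J"
    by (simp add: J_anti_invariant_forms_def)
  moreover have "anti_coords \<beta> = p"
    by (simp add: anti_coords_def \<beta> f_def x_e p)
  ultimately show ?thesis by (rule that)
qed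

end

text \<open>\<open>J\<close> makes the space a complex vector space, and \<open>e\<^sub>1, e\<^sub>3\<close> are a complex basis of it: \<open>e\<^sub>1\<close> is
  any nonzero vector, and \<open>e\<^sub>3\<close> any vector outside the complex line spanned by \<open>e\<^sub>1\<close>.\<close>

lemma adapted_frame_exists:
  fixes J :: "'a::real_vector \<Rightarrow> 'a"
  assumes dim: "dim (UNIV :: 'a set) = 4" and acs: "almost_complex_structure J"
  obtains e1 e2 e3 e4 x1 x2 x3 x4 where "adapted_frame J e1 e2 e3 e4 x1 x2 x3 x4"
    and "\<And>f. linear f \<Longrightarrow> endo_trace f = x1 (f e1) + x2 (f e2) + x3 (f e3) + x4 (f e4)"
proof -
  have J: "linear J" and JJ: "J (J v) = - v" for v
    using acs by (auto simp: almost_complex_structure_def)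
  note J_simps = linear_add[OF J] linear_scale[OF J] linear_neg[OF J] JJ
  obtain B :: "'a set" where B: "independent B" "span B = UNIV" "card B = 4"
    using dim real_vector.basis_exists[of "UNIV :: 'a set"] by (metis top.extremum_uniqueI)
  have finB: "finite B" using B(3) card.infinite by fastforce
  have not_span: "\<exists>v. v \<notin> span S" if "finite S" "card S < 4" for S :: "'a set"
    using real_vector.independent_span_bound[OF that(1) B(1)] that(2) B(3) by force
  (* v and J v are independent modulo a J-invariant subspace not containing v: applying the
     complex conjugate coefficient a - b J to a v + b J v gives (a^2 + b^2) v. *)
  have key: "a = 0 \<and> b = 0"
    if S: "\<And>s. s \<in> span S \<Longrightarrow> J s \<in> span S" and v: "v \<notin> span S"
      and ab: "a *\<^sub>R v + b *\<^sub>R J v \<in> span S" for S :: "'a set" and v a b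
  proof (rule ccontr)
    assume "\<not> (a = 0 \<and> b = 0)"
    then have ne: "a * a + b * b \<noteq> 0" by (simp add: sum_squares_eq_zero_iff)
    have "a *\<^sub>R (a *\<^sub>R v + b *\<^sub>R J v) - b *\<^sub>R J (a *\<^sub>R v + b *\<^sub>R J v) \<in> span S"
      by (intro span_diff span_scale S ab)
    also have "a *\<^sub>R (a *\<^sub>R v + b *\<^sub>R J v) - b *\<^sub>R J (a *\<^sub>R v + b *\<^sub>R J v) = (a * a + b * b) *\<^sub>R v"
      by (simp add: J_simps algebra_simps)
    finally have "(1 / (a * a + b * b)) *\<^sub>R (a * a + b * b) *\<^sub>R v \<in> span S"
      by (rule span_scale)
    with v ne show False by (simp split: if_splits)
  qed
  obtain e1 :: 'a where e1: "e1 \<notin> span {}" using not_span[of "{}"] by auto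
  define e2 where "e2 = J e1"
  have inv1: "J s \<in> span {}" if "s \<in> span {}" for s
    using that linear_0[OF J] by simp
  have e2: "e2 \<notin> span {e1}"
  proof
    assume "e2 \<in> span {e1}"
    then obtain k where "e2 - k *\<^sub>R e1 \<in> span {}"
      using span_breakdown_eq[of e2 e1 "{}"] by auto
    then have "(- k) *\<^sub>R e1 + 1 *\<^sub>R J e1 \<in> span {}" by (simp add: e2_def)
    from key[OF inv1 e1 this] show False by simp
  qed
  have inv2: "J s \<in> span {e2, e1}" if "s \<in> span {e2, e1}" for s
  proof -
    have "J ` span {e2, e1} = span {- e1, e2}"
      using linear_span_image[OF J, of "{e2, e1}"] by (simp add: e2_def JJ)
    also have "\<dots> \<subseteq> span {e2, e1}"
      by (intro span_minimal) (auto intro: span_base span_neg)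
    finally show ?thesis using that by auto
  qed
  have "card {e2, e1} < 4" by (simp add: card_insert_if)
  then obtain e3 where e3: "e3 \<notin> span {e2, e1}" using not_span[of "{e2, e1}"] by auto
  define e4 where "e4 = J e3"
  have e4: "e4 \<notin> span {e3, e2, e1}"
  proof
    assume "e4 \<in> span {e3, e2, e1}"
    then obtain k where "e4 - k *\<^sub>R e3 \<in> span {e2, e1}"
      using span_breakdown_eq[of e4 e3 "{e2, e1}"] by auto
    then have "(- k) *\<^sub>R e3 + 1 *\<^sub>R J e3 \<in> span {e2, e1}" by (simp add: e4_def)
    from key[OF inv2 e3 this] show False by simp
  qed
  define F where "F = {e4, e3, e2, e1}"
  have ne: "e2 \<noteq> e1" "e3 \<noteq> e2" "e3 \<noteq> e1" "e4 \<noteq> e3" "e4 \<noteq> e2" "e4 \<noteq> e1"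
    using e2 e3 e4 by (auto intro: span_base)
  have F: "independent F" "finite F" "card F = 4"
    using e1 e2 e3 e4 ne by (simp_all add: F_def independent_insert)
  have "v \<in> span F" for v
  proof (rule ccontr)
    assume "v \<notin> span F"
    then have "independent (insert v F)" "card (insert v F) = 5"
      using F span_base[of v F] by (auto simp: independent_insert card_insert_if)
    then show False
      using real_vector.independent_span_bound[OF finB, of "insert v F"] B by simp
  qed
  then have spanF: "span F = UNIV" by auto
  define x where "x b v = representation F v b" for b v
  have x_linear: "linear (x b)" for b
    by (rule linearI)
      (simp_all add: x_def real_vector.representation_add[OF F(1)]
        real_vector.representation_scale[OF F(1)] spanF)
  have x_basis: "x b c = (if b = c then 1 else 0)" if "c \<in> F" for b c
    using real_vector.representation_basis[OF F(1) that] by (simp add: x_def)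
  have expand: "v = x e1 v *\<^sub>R e1 + x e2 v *\<^sub>R e2 + x e3 v *\<^sub>R e3 + x e4 v *\<^sub>R e4" for v
  proof -
    have "v = (\<Sum>b\<in>F. x b v *\<^sub>R b)"
      using real_vector.sum_representation_eq[OF F(1) _ F(2) subset_refl, of v] spanF
      by (simp add: x_def)
    also have "\<dots> = x e1 v *\<^sub>R e1 + x e2 v *\<^sub>R e2 + x e3 v *\<^sub>R e3 + x e4 v *\<^sub>R e4"
      using ne by (simp add: F_def algebra_simps)
    finally show ?thesis .
  qed
  show ?thesis
  proof (rule that)
    show "adapted_frame J e1 e2 e3 e4 (x e1) (x e2) (x e3) (x e4)"
    proof (rule adapted_frame.intro)
      show "J e1 = e2" "J e2 = - e1" "J e3 = e4" "J e4 = - e3"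
        by (simp_all add: e2_def e4_def JJ)
      show "v = x e1 v *\<^sub>R e1 + x e2 v *\<^sub>R e2 + x e3 v *\<^sub>R e3 + x e4 v *\<^sub>R e4" for v
        by (rule expand)
    qed (use ne in \<open>auto simp: J x_linear x_basis F_def\<close>)
    show "endo_trace f = x e1 (f e1) + x e2 (f e2) + x e3 (f e3) + x e4 (f e4)" if "linear f" for f
      unfolding endo_trace_eq[OF that F(1) spanF F(2)] x_def[symmetric]
      using ne by (simp add: F_def)
  qed
qed

section \<open>Stokes' theorem on a unimodular Lie algebra\<close>

locale unimodular_frame = adapted_frame +
  fixes br :: "'a \<Rightarrow> 'a \<Rightarrow> 'a"
  assumes lie: "lie_algebra br"
    and trace_ad: "x1 (br \<xi> e1) + x2 (br \<xi> e2) + x3 (br \<xi> e3) + x4 (br \<xi> e4) = 0"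
begin

text \<open>The right-hand side is \<open>\<phi> \<and> d\<alpha>\<close> on the frame, so this is the Leibniz rule for the 3-form
  \<open>\<phi> \<and> \<alpha>\<close>, whose differential vanishes by unimodularity: up to sign, d sends the 3-form
  \<open>vol(\<xi>, _, _, _)\<close> to \<open>vol\<close> times \<open>tr (ad \<xi>)\<close>.  In coordinates the four equations \<open>tr (ad e\<^sub>i) = 0\<close>
  are precisely what makes the two sides agree.\<close>

lemma wedge_top_exact:
  assumes \<alpha>: "\<alpha> \<in> alt_forms 2" and \<phi>: "\<phi> \<in> alt_forms 1"
  shows "wedge_top \<alpha> (ce_diff br \<phi>) =
      \<phi> [e1] * ce_diff br \<alpha> [e2, e3, e4] - \<phi> [e2] * ce_diff br \<alpha> [e1, e3, e4]
    + \<phi> [e3] * ce_diff br \<alpha> [e1, e2, e4] - \<phi> [e4] * ce_diff br \<alpha> [e1, e2, e3]"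
proof -
  note br = lie_algebra_bracket[OF lie]
  have sw: "br e2 e1 = - br e1 e2" "br e3 e1 = - br e1 e3" "br e4 e1 = - br e1 e4"
    "br e3 e2 = - br e2 e3" "br e4 e2 = - br e2 e4" "br e4 e3 = - br e3 e4"
    by (rule br(3))+
  (* tr (ad e_i) = 0, each solved for a structure constant absent from the other three equations. *)
  have tr: "x2 (br e1 e2) = - x3 (br e1 e3) - x4 (br e1 e4)"
    "x1 (br e1 e2) = x3 (br e2 e3) + x4 (br e2 e4)"
    "x4 (br e3 e4) = x1 (br e1 e3) + x2 (br e2 e3)"
    "x3 (br e3 e4) = - x1 (br e1 e4) - x2 (br e2 e4)"
    using trace_ad[of e1] trace_ad[of e2] trace_ad[of e3] trace_ad[of e4]
    by (simp_all add: sw br(2) x_simps)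
  show ?thesis
    unfolding wedge_top_def ce_diff_1 ce_diff_2
      linear_expand_real[OF alt_forms_1_linear[OF \<phi>], of "br _ _"]
      form_expand[OF \<alpha>, of "br _ _"]
    by (simp add: x_e tr algebra_simps)
qed

lemma ce_diff_eq_0_on_frame:
  assumes \<alpha>: "\<alpha> \<in> alt_forms 2"
    and zero: "ce_diff br \<alpha> [e2, e3, e4] = 0" "ce_diff br \<alpha> [e1, e3, e4] = 0"
      "ce_diff br \<alpha> [e1, e2, e4] = 0" "ce_diff br \<alpha> [e1, e2, e3] = 0"
  shows "ce_diff br \<alpha> [u, v, w] = 0"
proof -
  let ?F = "\<lambda>u v w. ce_diff br \<alpha> [u, v, w]"
  note alt = ce_diff_2_alternating[OF lie \<alpha>]
  have same: "?F u u w = 0" "?F u w w = 0" "?F u w u = 0" for u w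
    using alt(2)[of u u w] alt(3)[of u w w] alt(2)[of u w u] alt(3)[of w u u] by simp_all
  (* Each frame triple either repeats a vector or permutes one of the four assumed ones; multilinear
     extension then frees the arguments one at a time, moving each in turn to the first slot. *)
  have triple: "?F u v w = 0"
    if "u \<in> {e1, e2, e3, e4}" "v \<in> {e1, e2, e3, e4}" "w \<in> {e1, e2, e3, e4}" for u v w
  proof -
    have perm: "?F a b c = 0 \<and> ?F a c b = 0 \<and> ?F b a c = 0 \<and> ?F b c a = 0 \<and> ?F c a b = 0 \<and> ?F c b a = 0"
      if "?F a b c = 0" for a b c
      using that alt(2)[of a b c] alt(3)[of a b c] alt(3)[of b a c] alt(2)[of a c b]
        alt(2)[of b c a] alt(3)[of c a b] by simp
    show ?thesis
      using that perm[OF zero(1)] perm[OF zero(2)] perm[OF zero(3)] perm[OF zero(4)]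
      by (elim insertE emptyE) (simp_all add: same)
  qed
  have 1: "?F u v w = 0" if "v \<in> {e1, e2, e3, e4}" "w \<in> {e1, e2, e3, e4}" for u v w
    by (rule linear_eq_0_on_span[OF alt(1) _ span_frame]) (rule triple[OF _ that])
  have 2: "?F u v w = 0" if "w \<in> {e1, e2, e3, e4}" for u v w
    by (rule linear_eq_0_on_span[OF alt(1) _ span_frame]) (simp only: alt(2)[of _ v] 1 that minus_zero)
  show ?thesis
    by (rule linear_eq_0_on_span[OF alt(1) _ span_frame])
      (simp only: alt(2)[of _ v] alt(3)[of v _ w] 2 minus_zero)
qed

text \<open>That exact and closed forms are orthogonal is Stokes' theorem.  Conversely, testing \<open>\<alpha>\<close>
  against \<open>d x\<^sub>1, ..., d x\<^sub>4\<close> recovers, up to sign, each of the four components of \<open>d\<alpha>\<close>.\<close>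

lemma closed_iff_wedge_top_exact:
  assumes \<alpha>: "\<alpha> \<in> alt_forms 2"
  shows "\<alpha> \<in> closed_forms br 2 \<longleftrightarrow> (\<forall>\<beta>\<in>exact_forms br 2. wedge_top \<alpha> \<beta> = 0)"
proof
  assume "\<alpha> \<in> closed_forms br 2"
  then show "\<forall>\<beta>\<in>exact_forms br 2. wedge_top \<alpha> \<beta> = 0"
    using wedge_top_exact[OF \<alpha>]
    by (auto simp: closed_forms_def exact_forms_def numeral_2_eq_2)
next
  assume orth: "\<forall>\<beta>\<in>exact_forms br 2. wedge_top \<alpha> \<beta> = 0"
  define \<phi> :: "('a \<Rightarrow> real) \<Rightarrow> 'a list \<Rightarrow> real"
    where "\<phi> f = (\<lambda>xs. if length xs = 1 then f (hd xs) else 0)" for f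
  have "wedge_top \<alpha> (ce_diff br (\<phi> f)) = 0" and "\<phi> f \<in> alt_forms 1" if "linear f" for f
    using orth alt_forms_1I[OF that] by (auto simp: exact_forms_def numeral_2_eq_2 \<phi>_def)
  then have eq: "f e1 * ce_diff br \<alpha> [e2, e3, e4] - f e2 * ce_diff br \<alpha> [e1, e3, e4]
    + f e3 * ce_diff br \<alpha> [e1, e2, e4] - f e4 * ce_diff br \<alpha> [e1, e2, e3] = 0" if "linear f" for f
    using wedge_top_exact[OF \<alpha>, of "\<phi> f"] that by (simp add: \<phi>_def)
  have "ce_diff br \<alpha> [u, v, w] = 0" for u v w
    by (rule ce_diff_eq_0_on_frame[OF \<alpha>])
      (use eq[OF x_linear(1)] eq[OF x_linear(2)] eq[OF x_linear(3)] eq[OF x_linear(4)]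
        in \<open>simp_all add: x_e\<close>)
  moreover have "ce_diff br \<alpha> xs = 0" if "length xs \<noteq> 3" for xs
    using ce_diff_eq_0_off_degree[OF \<alpha>] that by simp
  ultimately have "ce_diff br \<alpha> xs = 0" for xs
    by (cases "length xs = 3") (auto simp: length_Suc_conv numeral_3_eq_3)
  with \<alpha> show "\<alpha> \<in> closed_forms br 2"
    by (auto simp: closed_forms_def)
qed

section \<open>The decomposition of closed forms\<close>

text \<open>Write the anti-invariant coordinates of \<open>\<omega>\<close> as \<open>w + w'\<close> with \<open>w\<close> in the space \<open>W\<close> of
  coordinates of exact forms and \<open>w'\<close> orthogonal to it.  The anti-invariant form with coordinates
  \<open>w'\<close> is orthogonal to all exact forms and hence closed; subtracting it and an exact form with
  coordinates \<open>w\<close> leaves a form without anti-invariant part.\<close>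

lemma closed_decomposition:
  assumes \<omega>: "\<omega> \<in> closed_forms br 2"
  obtains \<alpha> \<beta> where "\<alpha> \<in> closed_forms br 2 \<inter> J_invariant_forms J"
    and "\<beta> \<in> closed_forms br 2 \<inter> J_anti_invariant_forms J"
    and "\<omega> - (\<alpha> + \<beta>) \<in> exact_forms br 2"
proof -
  define W where "W = anti_coords ` exact_forms br 2"
  have "subspace W"
    unfolding subspace_def
  proof (intro conjI ballI allI)
    show "0 \<in> W"
      unfolding W_def using exact_forms_0 by (rule image_eqI[rotated]) (simp add: anti_coords_def zero_prod_def)
    have lincomb: "a *\<^sub>R p + b *\<^sub>R q \<in> W" if "p \<in> W" "q \<in> W" for a b p q
      using that exact_forms_lincomb anti_coords_lincomb[symmetric] unfolding W_def by blast
    show "p + q \<in> W" if "p \<in> W" "q \<in> W" for p q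
      using lincomb[OF that, of 1 1] by simp
    show "a *\<^sub>R p \<in> W" if "p \<in> W" for a p
      using lincomb[OF that that, of a 0] by simp
  qed
  then obtain w w' where w: "w \<in> W" and w': "\<And>y. y \<in> W \<Longrightarrow> orthogonal w' y"
    and sum: "anti_coords \<omega> = w + w'"
    using orthogonal_subspace_decomp_exists[of W "anti_coords \<omega>"]
    by (metis span_eq_iff)
  obtain \<eta> where \<eta>: "\<eta> \<in> exact_forms br 2" "anti_coords \<eta> = w"
    using w by (auto simp: W_def)
  obtain \<beta> where \<beta>: "\<beta> \<in> J_anti_invariant_forms J" "anti_coords \<beta> = w'"
    by (rule anti_invariant_form_with_coords)
  have \<beta>_alt: "\<beta> \<in> alt_forms 2" using \<beta> by (simp add: J_anti_invariant_forms_def)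
  have "wedge_top \<beta> \<gamma> = 0" if "\<gamma> \<in> exact_forms br 2" for \<gamma>
    using w'[of "anti_coords \<gamma>"] that
    by (simp add: wedge_top_commute[of \<beta>] wedge_top_anti_invariant[OF \<beta>(1)] \<beta>(2) W_def
        orthogonal_def inner_commute)
  then have \<beta>_closed: "\<beta> \<in> closed_forms br 2"
    using closed_iff_wedge_top_exact[OF \<beta>_alt] by blast
  define \<alpha> where "\<alpha> = (\<lambda>xs. 1 * \<omega> xs + (-1) * (1 * \<eta> xs + 1 * \<beta> xs))"
  have \<alpha>_closed: "\<alpha> \<in> closed_forms br 2"
    unfolding \<alpha>_def using \<omega> \<eta>(1) \<beta>_closed exact_forms_2_closed[OF lie]
    by (intro closed_forms_lincomb) auto
  have "anti_coords \<alpha> = 0"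
    unfolding \<alpha>_def anti_coords_lincomb by (simp add: \<eta> \<beta> sum)
  then have "\<alpha> \<in> J_invariant_forms J"
    using anti_coords_eq_0_iff_invariant \<alpha>_closed by (auto simp: closed_forms_def)
  moreover have "\<omega> - (\<alpha> + \<beta>) = \<eta>" by (auto simp: \<alpha>_def)
  ultimately show ?thesis
    using that \<alpha>_closed \<beta>_closed \<beta>(1) \<eta>(1) by simp
qed

text \<open>The closed form \<open>\<beta>\<close> is orthogonal to the exact form \<open>\<alpha> + \<beta>\<close> and, being anti-invariant, to the
  invariant form \<open>\<alpha>\<close>; so it is orthogonal to itself.\<close>

lemma anti_invariant_eq_0_if_plus_invariant_exact:
  assumes \<alpha>: "\<alpha> \<in> J_invariant_forms J"
    and \<beta>: "\<beta> \<in> closed_forms br 2 \<inter> J_anti_invariant_forms J"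
    and exact: "\<alpha> + \<beta> \<in> exact_forms br 2"
  shows "\<beta> = 0"
proof -
  have alt: "\<alpha> \<in> alt_forms 2" "\<beta> \<in> alt_forms 2"
    using \<alpha> \<beta> by (auto simp: J_invariant_forms_def closed_forms_def)
  have \<beta>_anti: "\<beta> \<in> J_anti_invariant_forms J" using \<beta> by simp
  have "anti_coords (\<alpha> + \<beta>) = anti_coords \<alpha> + anti_coords \<beta>"
    by (simp add: anti_coords_def)
  also have "anti_coords \<alpha> = 0"
    using anti_coords_eq_0_iff_invariant[OF alt(1)] \<alpha> by simp
  finally have "anti_coords (\<alpha> + \<beta>) = anti_coords \<beta>" by (simp only: add_0_left)
  moreover have "wedge_top (\<alpha> + \<beta>) \<beta> = 0"
    using closed_iff_wedge_top_exact[OF alt(2)] \<beta> exact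
    by (subst wedge_top_commute) blast
  ultimately have "anti_coords \<beta> = 0"
    by (simp add: wedge_top_anti_invariant[OF \<beta>_anti])
  then show ?thesis
    using form_eqI[OF alt(2), of 0] anti_invariant_eq_0[OF \<beta>_anti]
    by (auto simp: alt_forms_def linear_iff)
qed

end

theorem theorem3p3:
  fixes br :: "'a::real_vector \<Rightarrow> 'a \<Rightarrow> 'a" and J :: "'a \<Rightarrow> 'a"
  assumes "lie_algebra br"
    and "dim (UNIV :: 'a set) = 4"
    and "unimodular br"
    and "almost_complex_structure J"
  shows "internal_direct_sum (ce_cohomology br 2) (H_J_plus br J) (H_J_minus br J)"
proof -
  obtain e1 e2 e3 e4 x1 x2 x3 x4 where frame: "adapted_frame J e1 e2 e3 e4 x1 x2 x3 x4"
    and tr: "\<And>f. linear f \<Longrightarrow> endo_trace f = x1 (f e1) + x2 (f e2) + x3 (f e3) + x4 (f e4)"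
    using adapted_frame_exists[OF assms(2,4)] by blast
  have "linear (br \<xi>)" for \<xi>
    using lie_algebra_bracket(1)[OF assms(1)] by (simp add: bilinear_def)
  then have "x1 (br \<xi> e1) + x2 (br \<xi> e2) + x3 (br \<xi> e3) + x4 (br \<xi> e4) = 0" for \<xi>
    using tr[of "br \<xi>"] assms(3) by (simp add: unimodular_def)
  then interpret unimodular_frame J e1 e2 e3 e4 x1 x2 x3 x4 br
    using frame assms(1) by (simp add: unimodular_frame_def unimodular_frame_axioms_def)
  let ?P = "closed_forms br 2 \<inter> J_invariant_forms J"
  let ?M = "closed_forms br 2 \<inter> J_anti_invariant_forms J"
  let ?cl = "ce_class br 2"
  have closed_add: "\<alpha> + \<beta> \<in> closed_forms br 2" and closed_diff: "\<alpha> - \<beta> \<in> closed_forms br 2"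
    if "\<alpha> \<in> closed_forms br 2" "\<beta> \<in> closed_forms br 2" for \<alpha> \<beta>
    using closed_forms_lincomb[OF that, of 1 1] closed_forms_lincomb[OF that, of 1 "-1"]
    by (simp_all add: plus_fun_def fun_diff_def)
  have diff_P: "\<alpha> - \<alpha>' \<in> ?P" if "\<alpha> \<in> ?P" "\<alpha>' \<in> ?P" for \<alpha> \<alpha>'
    using that closed_diff[of \<alpha> \<alpha>'] by (auto simp: J_invariant_forms_def closed_forms_def)
  have diff_M: "\<beta> - \<beta>' \<in> ?M" if "\<beta> \<in> ?M" "\<beta>' \<in> ?M" for \<beta> \<beta>'
    using that closed_diff[of \<beta> \<beta>'] by (auto simp: J_anti_invariant_forms_def closed_forms_def)
  have "inj_on (\<lambda>(a, b). a + b) (H_J_plus br J \<times> H_J_minus br J)"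
  proof (rule inj_onI)
    fix c c'
    assume "c \<in> H_J_plus br J \<times> H_J_minus br J" "c' \<in> H_J_plus br J \<times> H_J_minus br J"
    then obtain \<alpha> \<beta> \<alpha>' \<beta>' where *: "\<alpha> \<in> ?P" "\<alpha>' \<in> ?P" "\<beta> \<in> ?M" "\<beta>' \<in> ?M"
      and c: "c = (?cl \<alpha>, ?cl \<beta>)" "c' = (?cl \<alpha>', ?cl \<beta>')"
      unfolding H_J_plus_def H_J_minus_def by blast
    assume "(\<lambda>(a, b). a + b) c = (\<lambda>(a, b). a + b) c'"
    then have eq: "?cl \<alpha> + ?cl \<beta> = ?cl \<alpha>' + ?cl \<beta>'" by (simp add: c)
    have exact: "(\<alpha> - \<alpha>') + (\<beta> - \<beta>') \<in> exact_forms br 2"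
      using eq by (simp add: ce_class_add ce_class_eq_iff algebra_simps)
    then have "\<beta> - \<beta>' = 0"
      using anti_invariant_eq_0_if_plus_invariant_exact diff_P[of \<alpha> \<alpha>'] diff_M[of \<beta> \<beta>'] * by blast
    with exact show "c = c'"
      by (simp add: c ce_class_eq_iff)
  qed
  moreover have "(\<lambda>(a, b). a + b) ` (H_J_plus br J \<times> H_J_minus br J) = ce_cohomology br 2"
  proof (intro equalityI subsetI)
    fix c assume "c \<in> (\<lambda>(a, b). a + b) ` (H_J_plus br J \<times> H_J_minus br J)"
    then show "c \<in> ce_cohomology br 2"
      using closed_add by (auto simp: H_J_plus_def H_J_minus_def ce_cohomology_def ce_class_add)
  next
    fix c assume "c \<in> ce_cohomology br 2"
    then obtain \<omega> where \<omega>: "\<omega> \<in> closed_forms br 2" "c = ?cl \<omega>"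
      by (auto simp: ce_cohomology_def)
    obtain \<alpha> \<beta> where *: "\<alpha> \<in> ?P" "\<beta> \<in> ?M" "\<omega> - (\<alpha> + \<beta>) \<in> exact_forms br 2"
      using closed_decomposition[OF \<omega>(1)] by blast
    then have "c = ?cl \<alpha> + ?cl \<beta>"
      by (simp add: \<omega>(2) ce_class_add ce_class_eq_iff)
    with * show "c \<in> (\<lambda>(a, b). a + b) ` (H_J_plus br J \<times> H_J_minus br J)"
      unfolding H_J_plus_def H_J_minus_def by blast
  qed
  ultimately show ?thesis
    by (auto simp: internal_direct_sum_def bij_betw_def H_J_plus_def H_J_minus_def ce_cohomology_def)
qed

end
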